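(* Let $M$ be a matrix with nonnegative real entries, and let $N$ be a real rank-$r$ matrix of the same dimensions such that $M_{ij}=N_{ij}^2$ for all $i,j$. Then there exists a one-way quantum protocol using $(r+1)$-dimensional pure-state messages that computes $M$ in expectation.
   Context: All matrices are real; PSD means symmetric positive semidefinite. A $D$-dimensional quantum state is a $D\times D$ PSD matrix $\rho$ of trace $1$; it is a pure state if it has rank $1$, i.e. $\rho=\phi\phi^{\intercal}$ for a unit column vector $\phi\in\mathbb{R}^D$. A POVM in dimension $D$ is a finite family $\{E_\theta\}_{\theta\in\Theta}$ of $D\times D$ PSD matrices, labeled by distinct real numbers $\theta$, with $\sum_\theta E_\theta=I$; measuring $\rho$ yields outcome $\theta$ with probability $\operatorname{Tr}[E_\theta\rho]$. A one-way quantum protocol with $D$-dimensional messages consists of a $D$-dimensional state $\rho_i$ for each row index $i$ (sent by Alice on input $i$) and, for each column index $j$, a POVM $\{E^j_\theta\}$ in dimension $D$ whose labels $\theta$ are all nonnegative (with which Bob, on input $j$, measures the received state, outputting the outcome). It uses pure-state messages if every $\rho_i$ is pure. It computes $M$ in expectation if the expected output $\sum_\theta\theta\operatorname{Tr}[E^j_\theta\rho_i]$ equals $M_{ij}$ for all $i,j$. *)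

theory Defs
  imports "Jordan_Normal_Form.DL_Rank"
begin

definition mat_trace :: "real mat \<Rightarrow> real" where
  "mat_trace A = (\<Sum>i<dim_row A. A $$ (i, i))"

definition psd :: "nat \<Rightarrow> real mat \<Rightarrow> bool" where
  "psd D A \<longleftrightarrow> A \<in> carrier_mat D D \<and> transpose_mat A = A \<and>
     (\<forall>v \<in> carrier_vec D. 0 \<le> v \<bullet> (A *\<^sub>v v))"

definition quantum_state :: "nat \<Rightarrow> real mat \<Rightarrow> bool" where
  "quantum_state D \<rho> \<longleftrightarrow> psd D \<rho> \<and> mat_trace \<rho> = 1"

definition pure_state :: "nat \<Rightarrow> real mat \<Rightarrow> bool" where
  "pure_state D \<rho> \<longleftrightarrow> quantum_state D \<rho> \<and> vec_space.rank D \<rho> = 1"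

(* The outcomes form a finite set of reals, so distinct outcomes carry distinct labels;
   values of E outside this set are irrelevant. *)
definition povm :: "nat \<Rightarrow> real set \<Rightarrow> (real \<Rightarrow> real mat) \<Rightarrow> bool" where
  "povm D \<Theta> E \<longleftrightarrow> finite \<Theta> \<and> (\<forall>\<theta>\<in>\<Theta>. psd D (E \<theta>)) \<and>
     finsum (ring_mat TYPE(real) D ()) E \<Theta> = 1\<^sub>m D"

definition outcome_prob :: "(real \<Rightarrow> real mat) \<Rightarrow> real mat \<Rightarrow> real \<Rightarrow> real" where
  "outcome_prob E \<rho> \<theta> = mat_trace (E \<theta> * \<rho>)"

definition expected_output :: "real set \<Rightarrow> (real \<Rightarrow> real mat) \<Rightarrow> real mat \<Rightarrow> real" where
  "expected_output \<Theta> E \<rho> = (\<Sum>\<theta>\<in>\<Theta>. \<theta> * outcome_prob E \<rho> \<theta>)"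

(* Inputs are the row indices i < nr and column indices j < nc; \<rho> i is Alice's message,
   (\<Theta> j, E j) is Bob's measurement. *)
definition one_way_protocol ::
  "nat \<Rightarrow> nat \<Rightarrow> nat \<Rightarrow> (nat \<Rightarrow> real mat) \<Rightarrow> (nat \<Rightarrow> real set) \<Rightarrow> (nat \<Rightarrow> real \<Rightarrow> real mat) \<Rightarrow> bool" where
  "one_way_protocol D nr nc \<rho> \<Theta> E \<longleftrightarrow>
     (\<forall>i<nr. quantum_state D (\<rho> i)) \<and>
     (\<forall>j<nc. povm D (\<Theta> j) (E j) \<and> (\<forall>\<theta>\<in>\<Theta> j. 0 \<le> \<theta>))"

definition uses_pure_messages :: "nat \<Rightarrow> nat \<Rightarrow> (nat \<Rightarrow> real mat) \<Rightarrow> bool" where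
  "uses_pure_messages D nr \<rho> \<longleftrightarrow> (\<forall>i<nr. pure_state D (\<rho> i))"

definition computes_in_expectation ::
  "(nat \<Rightarrow> real mat) \<Rightarrow> (nat \<Rightarrow> real set) \<Rightarrow> (nat \<Rightarrow> real \<Rightarrow> real mat) \<Rightarrow> real mat \<Rightarrow> bool" where
  "computes_in_expectation \<rho> \<Theta> E M \<longleftrightarrow>
     (\<forall>i<dim_row M. \<forall>j<dim_col M. expected_output (\<Theta> j) (E j) (\<rho> i) = M $$ (i, j))"

end

theory Submission
  imports Defs "HOL-Analysis.Convex"
begin

text \<open>
  Factor \<open>N\<close> through dimension \<open>r\<close>, so that \<open>N $$ (i, j)\<close> is the inner product of \<open>a i\<close> and
  \<open>b j\<close>, and rescale so that every \<open>a i\<close> has norm at most 1. One extra coordinate turns \<open>a i\<close>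
  into a unit vector, which Alice sends as a pure state. If \<open>w\<close> is \<open>b j\<close> (padded by 0) divided
  by \<open>sqrt t\<close>, with \<open>t\<close> so large that \<open>w\<close> has norm at most 1, then Bob's measurement
  \<open>{w w\<^sup>T, 1 - w w\<^sup>T}\<close> with labels \<open>t\<close> and \<open>0\<close> has expected output
  \<open>t * (w \<bullet> a i)\<^sup>2 = (b j \<bullet> a i)\<^sup>2\<close>.
\<close>

unbundle no inner_syntax

text \<open>A maximal linearly independent set \<open>U\<close> of columns has \<open>r\<close>
  elements and spans all columns. Then \<open>f\<close> collects the entries of these basis columns,
  and \<open>g\<close> the coefficients of each column in terms of them.\<close>

lemma rank_factorization:
  fixes A :: "'a::field mat"
  assumes A: "A \<in> carrier_mat n nc" and r: "vec_space.rank n A = r"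
  obtains f g where "\<And>i j. i < n \<Longrightarrow> j < nc \<Longrightarrow> A $$ (i, j) = (\<Sum>k<r. f i k * g k j)"
proof -
  interpret vec_space "TYPE('a)" n .
  let ?P = "\<lambda>T. T \<subseteq> set (cols A) \<and> lin_indpt T"
  have cols_in: "set (cols A) \<subseteq> carrier_vec n"
    using A cols_dim by blast
  have "?P {}"
    by (metis empty_subsetI fin_dim finite_basis_exists subset_li_is_li vec_vs vectorspace.basis_def)
  then obtain U where U: "finite U" "maximal U ?P"
    using maximal_exists_superset[of "set (cols A)" ?P "{}"] by blast
  have card: "card U = r"
    using rank_card_indpt[OF A U(2)] r by simp
  have sub: "U \<subseteq> set (cols A)" and li: "lin_indpt U"
    using U(2) unfolding maximal_def by auto
  have U_in: "U \<subseteq> carrier_vec n"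
    using sub cols_in by blast
  have in_span: "v \<in> span U" if v: "v \<in> set (cols A)" for v
  proof (rule ccontr)
    assume nv: "v \<notin> span U"
    have "v \<notin> U"
      using nv U_in span_mem by auto
    moreover have "lin_indpt (insert v U)"
      using nv v li lin_dep_iff_in_span[of U v] U_in cols_in \<open>v \<notin> U\<close> by auto
    ultimately show False
      using U(2) v sub unfolding maximal_def by blast
  qed
  have "\<exists>a. col A j = lincomb a U" if "j < nc" for j
  proof -
    have "col A j \<in> set (cols A)"
      using that A by (metis carrier_matD(2) cols_length cols_nth nth_mem)
    then show ?thesis
      using in_span finite_in_span[OF U(1)] U_in by metis
  qed
  then obtain a where a: "\<And>j. j < nc \<Longrightarrow> col A j = lincomb (a j) U"
    by metis
  obtain h where h: "bij_betw h {..<r} U"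
    using ex_bij_betw_nat_finite[OF U(1)] card by (auto simp: atLeast0LessThan)
  show thesis
  proof (rule that[of "\<lambda>i k. h k $ i" "\<lambda>k j. a j (h k)"])
    fix i j assume i: "i < n" and j: "j < nc"
    have "A $$ (i, j) = lincomb (a j) U $ i"
      using i j A a[OF j] by (metis carrier_matD index_col)
    also have "\<dots> = (\<Sum>x\<in>U. a j x * x $ i)"
      by (rule lincomb_index[OF i U_in])
    also have "\<dots> = (\<Sum>k<r. a j (h k) * h k $ i)"
      using sum.reindex_bij_betw[OF h, of "\<lambda>x. a j x * x $ i"] by simp
    finally show "A $$ (i, j) = (\<Sum>k<r. h k $ i * a j (h k))"
      by (simp add: mult.commute)
  qed
qed

lemma scalar_prod_Cauchy_Schwarz:
  fixes u v :: "real vec"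
  assumes "u \<in> carrier_vec n" "v \<in> carrier_vec n"
  shows "(u \<bullet> v)\<^sup>2 \<le> (u \<bullet> u) * (v \<bullet> v)"
  using assms Cauchy_Schwarz_ineq_sum[of "($) u" "($) v" "{0..<n}"]
  by (simp add: scalar_prod_def power2_eq_square)

lemma scalar_prod_self_nonneg: "0 \<le> v \<bullet> (v :: real vec)"
  by (simp add: scalar_prod_def sum_nonneg)

definition outer :: "real vec \<Rightarrow> real mat" where
  "outer u = mat (dim_vec u) (dim_vec u) (\<lambda>(i, j). u $ i * u $ j)"

lemma outer_carrier: "u \<in> carrier_vec n \<Longrightarrow> outer u \<in> carrier_mat n n"
  by (simp add: outer_def)

lemma outer_quadratic_form:
  assumes "u \<in> carrier_vec n" "v \<in> carrier_vec n"
  shows "v \<bullet> (outer u *\<^sub>v v) = (u \<bullet> v)\<^sup>2"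
  using assms
  by (simp add: outer_def scalar_prod_def power2_eq_square sum_product sum_distrib_left
      mult_ac)

lemma psd_outer: "u \<in> carrier_vec n \<Longrightarrow> psd n (outer u)"
  by (auto simp: psd_def outer_quadratic_form outer_carrier) (auto simp: outer_def mult.commute)

text \<open>The quadratic form is \<open>v \<bullet> v\<close> minus the square of
  \<open>u \<bullet> v\<close>, so this is Cauchy-Schwarz for \<open>u\<close> of norm at most
  1.\<close>

lemma psd_one_minus_outer:
  assumes u: "u \<in> carrier_vec n" and "u \<bullet> u \<le> 1"
  shows "psd n (1\<^sub>m n - outer u)"
  unfolding psd_def
proof (intro conjI ballI)
  show "(1\<^sub>m n - outer u)\<^sup>T = 1\<^sub>m n - outer u"
    using u by (auto simp: outer_def mult.commute)
  fix v :: "real vec" assume v: "v \<in> carrier_vec n"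
  have "(u \<bullet> v)\<^sup>2 \<le> v \<bullet> v"
    using scalar_prod_Cauchy_Schwarz[OF u v] mult_right_mono[OF assms(2) scalar_prod_self_nonneg[of v]]
    by simp
  moreover have "v \<bullet> ((1\<^sub>m n - outer u) *\<^sub>v v) = v \<bullet> v - (u \<bullet> v)\<^sup>2"
    using u v outer_carrier[OF u] outer_quadratic_form[OF u v]
    by (simp add: minus_mult_distrib_mat_vec[of _ n n] scalar_prod_minus_distrib[of _ n])
  ultimately show "0 \<le> v \<bullet> ((1\<^sub>m n - outer u) *\<^sub>v v)"
    by simp
qed (rule minus_carrier_mat[OF outer_carrier[OF u]])

lemma mat_trace_outer: "mat_trace (outer u) = u \<bullet> u"
  by (simp add: mat_trace_def outer_def scalar_prod_def atLeast0LessThan)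

lemma mat_trace_outer_mult:
  assumes "u \<in> carrier_vec n" "v \<in> carrier_vec n"
  shows "mat_trace (outer u * outer v) = (u \<bullet> v)\<^sup>2"
  using assms
  by (simp add: mat_trace_def outer_def scalar_prod_def atLeast0LessThan power2_eq_square
      sum_product mult_ac)

lemma pure_state_outer:
  assumes u: "u \<in> carrier_vec n" and unit: "u \<bullet> u = 1"
  shows "pure_state n (outer u)"
proof -
  have "vec_space.rank n (outer u) \<le> 1"
    using u by (intro vec_space.rank_le_1_product_entries[of _ _ n "($) u" "($) u"])
      (auto simp: outer_def)
  moreover have "vec_space.rank n (outer u) \<noteq> 0"
  proof
    assume "vec_space.rank n (outer u) = 0"
    \<comment> \<open>A factorization through dimension 0 writes every entry as an empty
      sum.\<close>
    then have "outer u $$ (i, i) = 0" if "i < n" for i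
      using that by (auto elim: rank_factorization[OF outer_carrier[OF u]])
    then have "mat_trace (outer u) = 0"
      using outer_carrier[OF u] by (simp add: mat_trace_def)
    then show False
      using unit by (simp add: mat_trace_outer)
  qed
  ultimately show ?thesis
    using psd_outer[OF u] unit by (simp add: pure_state_def quantum_state_def mat_trace_outer)
qed

text \<open>Among the labels \<open>0\<close> and \<open>t\<close> with \<open>0 < t\<close>, the
  else branch is the effect of label \<open>0\<close>.\<close>

definition binary_povm :: "nat \<Rightarrow> real vec \<Rightarrow> real \<Rightarrow> real \<Rightarrow> real mat" where
  "binary_povm n w t \<theta> = (if \<theta> = t then outer w else 1\<^sub>m n - outer w)"

lemma povm_binary_povm:
  assumes w: "w \<in> carrier_vec n" "w \<bullet> w \<le> 1" and t: "0 < t"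
  shows "povm n {0, t} (binary_povm n w t)"
proof -
  interpret ring "ring_mat TYPE(real) n ()"
    by (rule ring_mat)
  have "outer w \<in> carrier_mat n n"
    using w(1) by (rule outer_carrier)
  moreover have "1\<^sub>m n - outer w + outer w = 1\<^sub>m n"
    using w by (auto simp: outer_def)
  \<comment> \<open>Positivity of \<open>t\<close> makes the two labels distinct, so the sum has
    exactly two terms.\<close>
  ultimately have "finsum (ring_mat TYPE(real) n ()) (binary_povm n w t) {0, t} = 1\<^sub>m n"
    using t by (subst finsum_insert) (auto simp: binary_povm_def ring_mat_simps)
  then show ?thesis
    using w t psd_outer psd_one_minus_outer by (auto simp: povm_def binary_povm_def)
qed

text \<open>Label \<open>0\<close> contributes nothing to the expectation, whatever its
  probability.\<close>

lemma expected_output_binary_povm: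
  assumes "w \<in> carrier_vec n" "v \<in> carrier_vec n" "0 < t"
  shows "expected_output {0, t} (binary_povm n w t) (outer v) = t * (w \<bullet> v)\<^sup>2"
  using assms
  by (simp add: expected_output_def outcome_prob_def binary_povm_def mat_trace_outer_mult)

theorem theorem16:
  fixes M N :: "real mat" and nr nc r :: nat
  assumes "M \<in> carrier_mat nr nc"
    and "\<And>i j. i < nr \<Longrightarrow> j < nc \<Longrightarrow> 0 \<le> M $$ (i, j)"
    and "N \<in> carrier_mat nr nc"
    and "vec_space.rank nr N = r"
    and "\<And>i j. i < nr \<Longrightarrow> j < nc \<Longrightarrow> M $$ (i, j) = (N $$ (i, j))\<^sup>2"
  shows "\<exists>\<rho> \<Theta> E. one_way_protocol (r + 1) nr nc \<rho> \<Theta> E \<and>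
           uses_pure_messages (r + 1) nr \<rho> \<and>
           computes_in_expectation \<rho> \<Theta> E M"
proof -
  obtain a b where N: "\<And>i j. i < nr \<Longrightarrow> j < nc \<Longrightarrow> N $$ (i, j) = (\<Sum>k<r. a i k * b k j)"
    using rank_factorization[OF assms(3,4)] by blast
  define S where "S i = (\<Sum>k<r. (a i k)\<^sup>2)" for i
  \<comment> \<open>\<open>C\<close> bounds every \<open>S i\<close>; the summand 1 keeps it
    positive even if all \<open>S i\<close> vanish.\<close>
  define C where "C = 1 + (\<Sum>i<nr. S i)"
  define \<phi> where "\<phi> i = vec (r + 1) (\<lambda>k. if k < r then a i k / sqrt C else sqrt (1 - S i / C))" for i
  \<comment> \<open>This is 1 plus the squared norm of \<open>b j\<close> scaled by
    \<open>sqrt C\<close>, the factor that undoes Alice's rescaling. The 1 keeps \<open>t j\<close>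
    positive, hence different from the label \<open>0\<close>.\<close>
  define t where "t j = 1 + C * (\<Sum>k<r. (b k j)\<^sup>2)" for j
  define w where "w j = vec (r + 1) (\<lambda>k. if k < r then sqrt C * b k j / sqrt (t j) else 0)" for j
  have S_nonneg: "0 \<le> S i" for i
    by (simp add: S_def sum_nonneg)
  then have C: "0 < C"
    by (simp add: C_def add_pos_nonneg sum_nonneg)
  have t: "0 < t j" for j
    using C by (simp add: t_def add_pos_nonneg sum_nonneg)
  have S_le: "S i / C \<le> 1" if "i < nr" for i
    using member_le_sum[of i "{..<nr}" S] that S_nonneg C by (simp add: C_def)
  have \<phi>_in: "\<phi> i \<in> carrier_vec (r + 1)" for i
    by (simp add: \<phi>_def)
  have w_in: "w j \<in> carrier_vec (r + 1)" for j
    by (simp add: w_def)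
  have \<phi>_unit: "\<phi> i \<bullet> \<phi> i = 1" if "i < nr" for i
  proof -
    have "\<phi> i \<bullet> \<phi> i = (\<Sum>k<r. (a i k)\<^sup>2 / C) + (1 - S i / C)"
      using C S_le[OF that]
      by (simp add: \<phi>_def scalar_prod_def atLeast0LessThan power2_eq_square)
    then show ?thesis
      by (simp add: S_def sum_divide_distrib)
  qed
  have w_le: "w j \<bullet> w j \<le> 1" for j
  proof -
    have "w j \<bullet> w j = (\<Sum>k<r. C * (b k j)\<^sup>2 / t j)"
      using C t[of j]
      by (simp add: w_def scalar_prod_def atLeast0LessThan power_mult_distrib power_divide
          flip: power2_eq_square)
    also have "\<dots> = (t j - 1) / t j"
      by (simp add: t_def sum_distrib_left sum_divide_distrib)
    finally show ?thesis
      using t[of j] by simp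
  qed
  have overlap: "t j * (w j \<bullet> \<phi> i)\<^sup>2 = M $$ (i, j)" if ij: "i < nr" "j < nc" for i j
  proof -
    \<comment> \<open>The factors \<open>sqrt C\<close> cancel, and the last coordinate of
      \<open>w j\<close> is 0, so Alice's normalizing coordinate is invisible to Bob.\<close>
    have "w j \<bullet> \<phi> i = (\<Sum>k<r. a i k * b k j / sqrt (t j))"
      using C by (simp add: w_def \<phi>_def scalar_prod_def atLeast0LessThan mult_ac)
    also have "\<dots> = N $$ (i, j) / sqrt (t j)"
      by (simp add: N[OF ij] sum_divide_distrib)
    finally show ?thesis
      \<comment> \<open>Squaring leaves a factor \<open>1 / t j\<close>, which the label
        \<open>t j\<close> cancels.\<close>
      using t[of j] assms(5)[OF ij] by (simp add: power_divide)
  qed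
  let ?\<rho> = "\<lambda>i. outer (\<phi> i)"
  let ?\<Theta> = "\<lambda>j. {0, t j}"
  let ?E = "\<lambda>j. binary_povm (r + 1) (w j) (t j)"
  have pure: "uses_pure_messages (r + 1) nr ?\<rho>"
    using pure_state_outer[OF \<phi>_in \<phi>_unit] by (simp add: uses_pure_messages_def)
  moreover have "one_way_protocol (r + 1) nr nc ?\<rho> ?\<Theta> ?E"
    using pure povm_binary_povm[OF w_in w_le t] t
    by (auto simp: one_way_protocol_def uses_pure_messages_def pure_state_def less_imp_le)
  moreover have "computes_in_expectation ?\<rho> ?\<Theta> ?E M"
    using assms(1) expected_output_binary_povm[OF w_in \<phi>_in t] overlap
    by (simp add: computes_in_expectation_def)
  ultimately show ?thesis
    by blast
qed

end
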